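(* Let $L=\{001,110\}$. Then $\mathcal{G}_L$ is exactly the class of bipartite chain graphs.
   Context: All graphs are finite, simple, undirected, with nonempty vertex sets, and graph classes are considered up to isomorphism. A bipartite graph $G$ with partition classes $A,B$ is a bipartite chain graph if there is a linear ordering $\leq_A$ on $A$ such that $a_1\leq_A a_2$ implies $N(a_1)\subseteq N(a_2)$ for all $a_1,a_2\in A$ ($N$ denotes the neighborhood). For an alphabet $V$ and distinct $u,v\in V$, $h_{u,v}:V^*\to\{0,1\}^*$ is the monoid morphism with $u\mapsto 0$, $v\mapsto 1$ and $x\mapsto\lambda$ (empty word) for all other letters $x$. For a language $L\subseteq\{0,1\}^*$ closed under exchanging 0 and 1 and a nonempty word $w$ whose set of occurring letters is $V$, $G(L,w)$ is the graph with vertex set $V$ in which distinct $u,v$ are adjacent iff $h_{u,v}(w)\in L$. $\mathcal{G}_L$ is the class of all graphs isomorphic to some $G(L,w)$. *)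

theory Defs
  imports "Graph_Theory.Graph_Theory" "HOL-Library.Z2"
begin

text \<open>Undirected graphs are symmetric loop-free digraphs: both orientations of an edge are arcs.\<close>

definition simple_graph :: "'a pair_pre_digraph \<Rightarrow> bool" where
  "simple_graph G \<longleftrightarrow> pair_graph G \<and> pverts G \<noteq> {}"

definition isomorphic :: "'a pair_pre_digraph \<Rightarrow> 'b pair_pre_digraph \<Rightarrow> bool" where
  "isomorphic G H \<longleftrightarrow> digraph_iso (with_proj G) (with_proj H)"

definition neighborhood :: "'a pair_pre_digraph \<Rightarrow> 'a \<Rightarrow> 'a set" where
  "neighborhood G v = {u. (v, u) \<in> parcs G}"

text \<open>A partition class may be empty, so a one-vertex graph is bipartite.\<close>

definition bipartition :: "'a pair_pre_digraph \<Rightarrow> 'a set \<Rightarrow> 'a set \<Rightarrow> bool" where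
  "bipartition G A B \<longleftrightarrow>
     A \<union> B = pverts G \<and> A \<inter> B = {} \<and> parcs G \<subseteq> A \<times> B \<union> B \<times> A"

definition bipartite_chain_graphs :: "'a pair_pre_digraph set" where
  "bipartite_chain_graphs =
     {G. simple_graph G \<and>
         (\<exists>A B. bipartition G A B \<and>
            (\<exists>r. linear_order_on A r \<and>
               (\<forall>a1\<in>A. \<forall>a2\<in>A. (a1, a2) \<in> r \<longrightarrow> neighborhood G a1 \<subseteq> neighborhood G a2)))}"

text \<open>The alphabet \<open>{0,1}\<close> is the two-element type \<^typ>\<open>bit\<close>, on which \<open>x \<mapsto> x + 1\<close> exchanges 0 and 1.\<close>

definition exchange_closed :: "bit list set \<Rightarrow> bool" where
  "exchange_closed L \<longleftrightarrow> (\<forall>x\<in>L. map (\<lambda>b. b + 1) x \<in> L)"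

definition proj_word :: "'v \<Rightarrow> 'v \<Rightarrow> 'v list \<Rightarrow> bit list" where
  "proj_word u v w = concat (map (\<lambda>x. if x = u then [0] else if x = v then [1] else []) w)"

text \<open>Meaningful as an undirected graph only if \<open>L\<close> is closed under exchanging 0 and 1;
  see \<open>simple_graph_word_graph\<close> below.\<close>

definition word_graph :: "bit list set \<Rightarrow> 'v list \<Rightarrow> 'v pair_pre_digraph" where
  "word_graph L w =
     \<lparr> pverts = set w,
       parcs = {(u, v). u \<in> set w \<and> v \<in> set w \<and> u \<noteq> v \<and> proj_word u v w \<in> L} \<rparr>"

text \<open>Words range over the letters \<^typ>\<open>nat\<close>, since a type cannot be quantified here. No graph is
  lost: \<open>word_graph_in_class\<close> below admits every alphabet.\<close>

definition word_graph_class :: "bit list set \<Rightarrow> 'a pair_pre_digraph set" where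
  "word_graph_class L =
     {G. simple_graph G \<and> (\<exists>w :: nat list. w \<noteq> [] \<and> isomorphic (word_graph L w) G)}"

lemma proj_word_swap:
  "u \<noteq> v \<Longrightarrow> proj_word v u w = map (\<lambda>b. b + 1) (proj_word u v w)"
  by (induction w) (auto simp: proj_word_def)

lemma simple_graph_word_graph:
  assumes "exchange_closed L" "w \<noteq> []"
  shows "simple_graph (word_graph L w)"
proof -
  have "finite (parcs (word_graph L w))"
    by (rule finite_subset[of _ "set w \<times> set w"]) (auto simp: word_graph_def)
  moreover have "sym (parcs (word_graph L w))"
  proof (rule symI)
    fix u v assume "(u, v) \<in> parcs (word_graph L w)"
    then show "(v, u) \<in> parcs (word_graph L w)"
      using assms(1) by (auto simp: word_graph_def exchange_closed_def proj_word_swap[of u v])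
  qed
  ultimately have "pair_graph (word_graph L w)"
    by unfold_locales (auto simp: word_graph_def symmetric_def)
  then show ?thesis
    using assms(2) by (simp add: simple_graph_def word_graph_def)
qed

lemma exchange_closed_001_110: "exchange_closed {[0,0,1], [1,1,0]}"
  by (simp add: exchange_closed_def)

lemma proj_word_map:
  assumes "inj_on f (insert u (insert v (set w)))"
  shows "proj_word (f u) (f v) (map f w) = proj_word u v w"
  using assms by (induction w) (auto simp: proj_word_def inj_on_def)

lemma isomorphicI:
  assumes "simple_graph G" "bij_betw f (pverts G) (pverts H)"
    and "parcs H = map_prod f f ` parcs G"
  shows "isomorphic G H"
proof -
  have G: "pair_graph G" using assms(1) by (simp add: simple_graph_def)
  interpret pair_graph G by (rule G)
  define h where "h = \<lparr>iso_verts = f, iso_arcs = map_prod f f, iso_head = snd, iso_tail = fst\<rparr>"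
  have f: "inj_on f (pverts G)" using assms(2) by (rule bij_betw_imp_inj_on)
  have "inj_on (map_prod f f) (parcs G)"
    by (rule inj_on_subset[OF map_prod_inj_on[OF f f]]) (auto dest: in_arcsD1 in_arcsD2)
  then have "pre_digraph.digraph_isomorphism (with_proj G) h"
    using f wf_digraph_axioms by (auto simp: pre_digraph.digraph_isomorphism_def h_def)
  moreover have "with_proj H = app_iso h (with_proj G)"
    using assms(2,3) by (simp add: with_proj_def app_iso_def h_def bij_betw_def)
  ultimately show ?thesis by (auto simp: isomorphic_def digraph_iso_def)
qed

lemma word_graph_in_class:
  fixes w :: "'v list" and G :: "'a pair_pre_digraph"
  assumes "exchange_closed L" "w \<noteq> []" "simple_graph G" "isomorphic (word_graph L w) G"
  shows "G \<in> word_graph_class L"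
proof -
  obtain f :: "'v \<Rightarrow> nat" where f: "inj_on f (set w)"
    using finite_imp_inj_to_nat_seg[of "set w"] by auto
  have sg: "simple_graph (word_graph L (map f w))"
    using assms by (intro simple_graph_word_graph) auto
  have eq: "u \<in> set w \<Longrightarrow> v \<in> set w \<Longrightarrow> proj_word (f u) (f v) (map f w) = proj_word u v w" for u v
    using f by (intro proj_word_map) (simp add: insert_absorb)
  have "parcs (word_graph L (map f w)) = map_prod f f ` parcs (word_graph L w)"
    using f eq by (auto simp: word_graph_def inj_on_def image_iff split: prod.splits)
  then have "isomorphic (word_graph L w) (word_graph L (map f w))"
    using f assms by (intro isomorphicI[where f = f] simple_graph_word_graph)
      (auto simp: word_graph_def bij_betw_def)
  moreover have "wf_digraph (with_proj (word_graph L w))"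
  proof -
    interpret pair_graph "word_graph L w"
      using simple_graph_word_graph[OF assms(1,2)] by (simp add: simple_graph_def)
    show ?thesis by (rule wf_digraph)
  qed
  ultimately have "isomorphic (word_graph L (map f w)) G"
    using assms(4) digraph_iso_swap digraph_iso_trans unfolding isomorphic_def by blast
  then show ?thesis using assms(2,3) by (force simp: word_graph_class_def)
qed

end

theory Submission
  imports Defs
begin

text \<open>An edge joins a letter occurring once to a letter occurring twice, both of whose occurrences
  come first. Hence neighborhoods of the once-occurring letters grow with their position in the word.
  Conversely, given a chain graph with classes \<open>A\<close> and \<open>B\<close>, list the vertices so that each \<open>b \<in> B\<close>
  precedes exactly those elements of \<open>A\<close> that are adjacent to it, and then double the elements
  of \<open>B\<close>.\<close>

section \<open>Isomorphism and relabelling of words\<close>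

text \<open>In a digraph built by \<open>with_proj\<close> the ends of an arc are its two
  components, so an isomorphism has no freedom on arcs once its vertex map is known.\<close>

lemma digraph_iso_with_projE:
  assumes "digraph_iso (with_proj G) (with_proj H)"
  obtains f where "inj_on f (pverts G)" "pverts H = f ` pverts G"
    "parcs H = map_prod f f ` parcs G"
proof -
  from assms obtain h where h: "pre_digraph.digraph_isomorphism (with_proj G) h"
      and H: "with_proj H = app_iso h (with_proj G)"
    by (auto simp: digraph_iso_def)
  have "iso_arcs h e = map_prod (iso_verts h) (iso_verts h) e" if "e \<in> parcs G" for e
  proof -
    have "iso_arcs h e \<in> parcs H"
      using arg_cong[OF H, of arcs] that by simp
    moreover have "fst (iso_arcs h e) = iso_verts h (fst e)" "snd (iso_arcs h e) = iso_verts h (snd e)"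
      using arg_cong[OF H, of "\<lambda>D. tail D (iso_arcs h e)"] arg_cong[OF H, of "\<lambda>D. head D (iso_arcs h e)"]
        h that by (simp_all add: app_iso_def pre_digraph.digraph_isomorphism_def)
    ultimately show ?thesis by (simp add: prod_eq_iff)
  qed
  then have "parcs H = map_prod (iso_verts h) (iso_verts h) ` parcs G"
    using arg_cong[OF H, of arcs] by (auto intro!: image_cong)
  moreover have "pverts H = iso_verts h ` pverts G"
    using arg_cong[OF H, of verts] by simp
  moreover have "inj_on (iso_verts h) (pverts G)"
    using h by (simp add: pre_digraph.digraph_isomorphism_def)
  ultimately show thesis using that by blast
qed

lemma word_graph_map:
  assumes "inj_on f (set w)"
  shows "parcs (word_graph L (map f w)) = map_prod f f ` parcs (word_graph L w)"
proof -
  have "proj_word (f u) (f v) (map f w) = proj_word u v w" if "u \<in> set w" "v \<in> set w" for u v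
    using assms that by (intro proj_word_map) (simp add: insert_absorb)
  then show ?thesis
    using assms by (auto simp: word_graph_def inj_on_def image_iff split: prod.splits)
qed

text \<open>Renaming the letters of a word along an isomorphism onto \<open>G\<close> yields a word
  over the vertices of \<open>G\<close> itself. Isomorphism can thus be traded for equality in the
  main argument.\<close>

lemma word_graph_class_eq:
  assumes "exchange_closed L"
  shows "word_graph_class L = {word_graph L w | w. w \<noteq> []}"
proof (intro set_eqI iffI)
  fix G assume "G \<in> word_graph_class L"
  then obtain w :: "nat list" where w: "w \<noteq> []" "isomorphic (word_graph L w) G"
    by (auto simp: word_graph_class_def)
  from w(2) obtain f where f: "inj_on f (set w)" "pverts G = f ` set w"
      "parcs G = map_prod f f ` parcs (word_graph L w)"
    unfolding isomorphic_def
    by (elim digraph_iso_with_projE) (auto simp: word_graph_def)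
  have "G = word_graph L (map f w)"
    using f word_graph_map[of f w L] by (intro pair_pre_digraph.equality) (auto simp: word_graph_def)
  then show "G \<in> {word_graph L w | w. w \<noteq> []}" using w(1) by blast
next
  fix G assume "G \<in> {word_graph L w | w. w \<noteq> []}"
  then obtain w where w: "G = word_graph L w" "w \<noteq> []" by blast
  have "simple_graph G" using w assms simple_graph_word_graph by blast
  moreover have "isomorphic G G"
    using \<open>simple_graph G\<close> by (intro isomorphicI[where f = id]) (auto simp: prod.map_id0)
  ultimately show "G \<in> word_graph_class L" using assms w by (intro word_graph_in_class[of L w]) auto
qed

section \<open>Projections to two letters\<close>

lemma proj_word_append: "proj_word u v (xs @ ys) = proj_word u v xs @ proj_word u v ys"
  by (simp add: proj_word_def)

lemma proj_word_eq_Nil: "u \<notin> set xs \<Longrightarrow> v \<notin> set xs \<Longrightarrow> proj_word u v xs = []"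
  by (induction xs) (auto simp: proj_word_def)

lemma proj_word_eq_replicate:
  "u \<notin> set xs \<Longrightarrow> proj_word u v xs = replicate (count_list xs v) 1"
  by (induction xs) (auto simp: proj_word_def)

lemma count_list_proj_word:
  assumes "u \<noteq> v"
  shows "count_list (proj_word u v w) 0 = count_list w u"
    "count_list (proj_word u v w) 1 = count_list w v"
  using assms by (induction w) (auto simp: proj_word_def)

text \<open>The projection is a single 0 between two blocks of 1s. Since 001 has two 0s, only 110
  can occur, and it puts both 1s in front.\<close>

lemma proj_word_once_iff:
  assumes "a \<notin> set xs" "a \<notin> set ys" "a \<noteq> u"
  shows "proj_word a u (xs @ a # ys) \<in> {[0,0,1], [1,1,0]} \<longleftrightarrow>
    count_list xs u = 2 \<and> count_list ys u = 0"
proof -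
  have "proj_word a u (xs @ a # ys) = replicate (count_list xs u) 1 @ 0 # replicate (count_list ys u) 1"
    using assms proj_word_append[of a u xs "[a] @ ys"] proj_word_append[of a u "[a]" ys]
    by (simp add: proj_word_eq_replicate) (simp add: proj_word_def)
  moreover have "replicate m (1::bit) @ 0 # replicate n 1 \<in> {[0,0,1], [1,1,0]} \<longleftrightarrow> m = 2 \<and> n = 0" for m n
    by (cases m; cases "m - 1"; cases "m - 2"; cases n) (auto simp: Cons_eq_append_conv append_eq_Cons_conv)
  ultimately show ?thesis by simp
qed

section \<open>Word graphs are chain graphs\<close>

lemma word_graph_in_bipartite_chain_graphs:
  assumes "w \<noteq> []"
  shows "word_graph {[0,0,1], [1,1,0]} w \<in> bipartite_chain_graphs"
proof -
  let ?L = "{[0,0,1], [1,1,0]} :: bit list set"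
  define G where "G = word_graph ?L w"
  define A where "A = {v \<in> set w. count_list w v = 1}"
  define pre where "pre v = takeWhile (\<lambda>x. x \<noteq> v) w" for v
  \<comment> \<open>Letters of \<open>A\<close> occur once, so \<open>length (pre x)\<close> is the
    position of \<open>x\<close>, and \<open>r\<close> orders \<open>A\<close> by position.\<close>
  define r where "r = {(x, y). x \<in> A \<and> y \<in> A \<and> length (pre x) \<le> length (pre y)}"
  have split: "\<exists>ys. w = pre v @ v # ys" if "v \<in> set w" for v
  proof -
    have "dropWhile (\<lambda>x. x \<noteq> v) w \<noteq> []" using that by (auto simp: dropWhile_eq_Nil_conv)
    then show ?thesis
      unfolding pre_def
      by (metis (mono_tags, lifting) hd_dropWhile list.collapse takeWhile_dropWhile_id)
  qed
  have pre_inj: "x = y" if "x \<in> A" "y \<in> A" "length (pre x) = length (pre y)" for x y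
  proof -
    obtain s t where "w = pre x @ x # s" "w = pre y @ y # t"
      using split \<open>x \<in> A\<close> \<open>y \<in> A\<close> A_def by blast
    then show ?thesis using that(3) by (metis append_eq_append_conv list.inject)
  qed
  have "linear_order_on A r"
    using pre_inj
    by (auto simp: linear_order_on_def partial_order_on_def preorder_on_def refl_on_def trans_def
        antisym_def total_on_def r_def)
  moreover have "bipartition G A (set w - A)"
  proof -
    \<comment> \<open>Each word of \<open>?L\<close> has one symbol once and the other twice, so
      exactly one end of an edge lies in \<open>A\<close>. Letters occurring three or more times are
      isolated and fall into the other class.\<close>
    have "(u \<in> A) \<noteq> (v \<in> A)" if "(u, v) \<in> parcs G" for u v
    proof -
      have "u \<noteq> v" "u \<in> set w" "v \<in> set w" "proj_word u v w \<in> ?L"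
        using that by (auto simp: G_def word_graph_def)
      then show ?thesis using count_list_proj_word[of u v w] by (auto simp: A_def)
    qed
    then show ?thesis
      by (fastforce simp: bipartition_def G_def word_graph_def A_def)
  qed
  moreover have "neighborhood G a1 \<subseteq> neighborhood G a2" if "(a1, a2) \<in> r" for a1 a2
  proof
    fix u assume "u \<in> neighborhood G a1"
    then have u: "u \<in> set w" "a1 \<noteq> u" "proj_word a1 u w \<in> ?L"
      by (auto simp: neighborhood_def G_def word_graph_def)
    have a: "a1 \<in> A" "a2 \<in> A" "length (pre a1) \<le> length (pre a2)" using that by (auto simp: r_def)
    obtain s t where st: "w = pre a1 @ a1 # s" "w = pre a2 @ a2 # t"
      using split a A_def by blast
    have once: "a \<notin> set xs \<and> a \<notin> set ys" if "a \<in> A" "w = xs @ a # ys" for a xs ys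
      using that by (auto simp: A_def count_list_0_iff[symmetric])
    have n: "count_list (pre a1) u = 2" "count_list s u = 0"
      using proj_word_once_iff[of a1 "pre a1" s u] once[OF a(1) st(1)] u st(1) by auto
    \<comment> \<open>All occurrences of \<open>u\<close> lie before \<open>a1\<close>; it remains
      to carry this over to the later letter \<open>a2\<close>.\<close>
    have cw: "count_list w u = 2"
      using n u by (subst st(1)) simp
    then have "u \<noteq> a2" using a by (auto simp: A_def)
    \<comment> \<open>Both \<open>pre a1\<close> and \<open>pre a2\<close> are prefixes of
      \<open>w\<close>, so the shorter is a prefix of the longer.\<close>
    have "take (length (pre a1)) w = take (length (pre a1)) (pre a2)"
      using a(3) by (subst st(2)) simp
    moreover have "take (length (pre a1)) w = pre a1"
      by (subst st(1)) simp
    ultimately have "pre a2 = pre a1 @ drop (length (pre a1)) (pre a2)"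
      by (metis append_take_drop_id)
    then have "count_list (pre a1) u \<le> count_list (pre a2) u"
      by (metis count_list_append le_add1)
    \<comment> \<open>With at least two occurrences of \<open>u\<close> already in
      \<open>pre a2\<close>, none is left for \<open>t\<close>.\<close>
    moreover have "count_list (pre a2) u + count_list t u = 2"
      using cw \<open>u \<noteq> a2\<close> by (subst (asm) st(2)) simp
    ultimately have "proj_word a2 u w \<in> ?L"
      using proj_word_once_iff[of a2 "pre a2" t u] once[OF a(2) st(2)] \<open>u \<noteq> a2\<close> n st(2) by auto
    then show "u \<in> neighborhood G a2"
      using u \<open>u \<noteq> a2\<close> a by (auto simp: neighborhood_def G_def word_graph_def A_def)
  qed
  moreover have "simple_graph G"
    unfolding G_def using exchange_closed_001_110 assms by (rule simple_graph_word_graph)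
  ultimately show ?thesis
    unfolding G_def[symmetric] bipartite_chain_graphs_def by blast
qed

section \<open>Chain graphs are word graphs\<close>

text \<open>By distinctness only the blocks of \<open>u\<close> and \<open>v\<close> survive the
  projection, giving 0 or 00 followed by 1 or 11. As the first symbol is 0, the only possible member
  of the language is 001.\<close>

lemma proj_word_double_iff:
  fixes A :: "'a set"
  assumes "distinct (xs @ u # ys @ v # zs)"
  defines "w \<equiv> concat (map (\<lambda>x. if x \<in> A then [x] else [x, x]) (xs @ u # ys @ v # zs))"
  shows "proj_word u v w \<in> {[0,0,1], [1,1,0]} \<longleftrightarrow> u \<notin> A \<and> v \<in> A"
proof -
  let ?d = "\<lambda>x. if x \<in> A then [x] else [x, x]"
  have nil: "proj_word u v (concat (map ?d qs)) = []" if "u \<notin> set qs" "v \<notin> set qs" for qs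
    using that by (intro proj_word_eq_Nil) (auto split: if_splits)
  have "u \<noteq> v" using assms by auto
  have "proj_word u v w = proj_word u v (?d u) @ proj_word u v (?d v)"
    using assms(1) by (simp add: w_def proj_word_append nil del: if_splits)
  then show ?thesis using \<open>u \<noteq> v\<close> by (simp add: proj_word_def)
qed

lemma parcs_word_graph_iff:
  "(u, v) \<in> parcs (word_graph L w) \<longleftrightarrow>
    u \<in> set w \<and> v \<in> set w \<and> u \<noteq> v \<and> proj_word u v w \<in> L"
  by (simp add: word_graph_def)

text \<open>The hypothesis \<open>before\<close> covers pairs in the order of \<open>zs\<close>. The
  reversed pairs follow because \<open>G\<close> is symmetric and the language is closed under
  exchange.\<close>

lemma word_graph_double:
  fixes G :: "'a pair_pre_digraph"
  assumes G: "simple_graph G" and bip: "bipartition G A B"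
    and zs: "distinct zs" "set zs = pverts G"
    and before: "\<And>xs u ys v ts. zs = xs @ u # ys @ v # ts \<Longrightarrow> (u, v) \<in> parcs G \<longleftrightarrow> u \<notin> A \<and> v \<in> A"
  shows "word_graph {[0,0,1], [1,1,0]} (concat (map (\<lambda>x. if x \<in> A then [x] else [x, x]) zs)) = G"
    (is "word_graph ?L ?w = G")
proof -
  interpret pair_graph G using G by (simp add: simple_graph_def)
  have w: "set ?w = pverts G" using zs(2) by (auto split: if_splits)
  have ordered: "(u, v) \<in> parcs G \<longleftrightarrow> proj_word u v ?w \<in> ?L" if "zs = xs @ u # ys @ v # ts" for u v xs ys ts
    using before[OF that] proj_word_double_iff[of xs u ys v ts A] zs(1) that by simp
  have symL: "proj_word u v w \<in> ?L \<longleftrightarrow> proj_word v u w \<in> ?L" if "u \<noteq> v" for u v :: 'a and w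
    using exchange_closed_001_110 proj_word_swap[OF that, of w] proj_word_swap[OF that[symmetric], of w]
    unfolding exchange_closed_def by (metis (no_types))
  have symG: "(u, v) \<in> parcs G \<longleftrightarrow> (v, u) \<in> parcs G" for u v
    using arcs_symmetric by blast
  have "(u, v) \<in> parcs G \<longleftrightarrow> proj_word u v ?w \<in> ?L" if uv: "u \<in> pverts G" "v \<in> pverts G" "u \<noteq> v" for u v
  proof -
    obtain xs ys where s: "zs = xs @ u # ys" using uv(1) zs(2) split_list[of u zs] by blast
    have "v \<in> set zs" using uv(2) zs(2) by simp
    then consider "v \<in> set xs" | "v \<in> set ys" using uv(3) unfolding s by auto
    then show ?thesis
    proof cases
      case 1
      then obtain ps qs where "xs = ps @ v # qs" using split_list[of v xs] by blast
      then show ?thesis using ordered[of ps v qs u ys] s symL[OF uv(3)] symG[of u v] by simp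
    next
      case 2
      then obtain ps qs where "ys = ps @ v # qs" using split_list[of v ys] by blast
      then show ?thesis using ordered[of xs u ps v qs] s by simp
    qed
  qed
  note adj = this
  have dom: "(u, v) \<in> parcs G \<Longrightarrow> u \<in> pverts G \<and> v \<in> pverts G \<and> u \<noteq> v" for u v
    using bip by (auto simp: bipartition_def)
  have "(u, v) \<in> parcs (word_graph ?L ?w) \<longleftrightarrow> (u, v) \<in> parcs G" for u v
    unfolding parcs_word_graph_iff w using adj[of u v] dom[of u v] by argo
  then have "parcs (word_graph ?L ?w) = parcs G" by (intro set_eqI) (simp only: split_paired_all)
  moreover have "pverts (word_graph ?L ?w) = pverts G"
    using w by (simp only: word_graph_def pair_pre_digraph.simps)
  ultimately show ?thesis by (intro pair_pre_digraph.equality) simp_all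
qed

lemma bipartite_chain_graph_eq_word_graph:
  assumes "G \<in> bipartite_chain_graphs"
  shows "\<exists>w. w \<noteq> [] \<and> G = word_graph {[0,0,1], [1,1,0]} w"
proof -
  obtain A B r where G: "simple_graph G" and bip: "bipartition G A B"
    and r: "linear_order_on A r"
      "\<And>a1 a2. a1 \<in> A \<Longrightarrow> a2 \<in> A \<Longrightarrow> (a1, a2) \<in> r \<Longrightarrow> neighborhood G a1 \<subseteq> neighborhood G a2"
    using assms unfolding bipartite_chain_graphs_def by blast
  interpret pair_graph G using G by (simp add: simple_graph_def)
  let ?N = "neighborhood G"
  have V: "A \<union> B = pverts G" "A \<inter> B = {}" "parcs G \<subseteq> A \<times> B \<union> B \<times> A"
    using bip by (auto simp: bipartition_def)
  have fin: "finite A" "finite (pverts G)"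
    using pair_finite_verts V(1) by (auto intro: rev_finite_subset[of "pverts G"])
  have chain: "?N a1 \<subseteq> ?N a2 \<or> ?N a2 \<subseteq> ?N a1" if "a1 \<in> A" "a2 \<in> A" for a1 a2
    using r(1) r(2)[OF that] r(2)[OF that(2,1)] that
    by (cases "a1 = a2") (auto simp: linear_order_on_def total_on_def)
  have symG: "(u, v) \<in> parcs G \<longleftrightarrow> (v, u) \<in> parcs G" for u v
    using arcs_symmetric by blast
  \<comment> \<open>The elements of \<open>A\<close> not adjacent to \<open>b\<close> form a downward closed set of the chain.\<close>
  define non where "non b = card {a \<in> A. b \<notin> ?N a}" for b
  define rank where "rank a = card {a' \<in> A. ?N a' \<subseteq> ?N a}" for a
  \<comment> \<open>The parities keep keys of \<open>A\<close> and \<open>B\<close> distinct and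
    break ties in favour of \<open>A\<close>: for \<open>b\<close> in \<open>B\<close>,
    \<open>key b < key a\<close> holds exactly when \<open>non b < rank a\<close>.\<close>
  define key where "key x = (if x \<in> A then 2 * rank x else 2 * non x + 1)" for x
  have adj: "(b, a) \<in> parcs G \<longleftrightarrow> non b < rank a" if "a \<in> A" for a b
  proof (cases "b \<in> ?N a")
    case True
    \<comment> \<open>A neighborhood missing \<open>b\<close> cannot contain \<open>?N a\<close>, so
      by comparability it is contained in it. The inclusion is strict because \<open>a\<close>
      itself belongs only to the right-hand set.\<close>
    then have "{a \<in> A. b \<notin> ?N a} \<subset> {a' \<in> A. ?N a' \<subseteq> ?N a}"
      using chain that by blast
    then have "non b < rank a"
      unfolding non_def rank_def using fin by (intro psubset_card_mono) auto
    then show ?thesis using True symG by (simp add: neighborhood_def)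
  next
    case False
    \<comment> \<open>Here every neighborhood contained in \<open>?N a\<close> misses
      \<open>b\<close> too.\<close>
    then have "rank a \<le> non b"
      unfolding non_def rank_def using fin by (intro card_mono) auto
    then show ?thesis using False symG by (simp add: neighborhood_def)
  qed
  obtain vs where vs: "set vs = pverts G" "distinct vs" using fin finite_distinct_list by blast
  define zs where "zs = sort_key key vs"
  have zs: "set zs = pverts G" "distinct zs" "sorted (map key zs)"
    using vs by (auto simp: zs_def)
  have "(u, v) \<in> parcs G \<longleftrightarrow> u \<notin> A \<and> v \<in> A" if "zs = xs @ u # ys @ v # ts" for xs u ys v ts
  proof -
    have le: "key u \<le> key v" using zs(3) that by (simp add: sorted_append)
    show ?thesis
    proof (cases "v \<in> A")
      case True
      have "\<not> ((u, v) \<in> parcs G \<and> u \<in> A)" using True V by blast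
      then show ?thesis using True le adj[OF True, of u] by (auto simp: key_def split: if_splits)
    next
      case False
      \<comment> \<open>An edge would force \<open>u\<close> into \<open>A\<close> and make
        \<open>key v\<close> smaller than \<open>key u\<close>, against the sorting.\<close>
      have "(u, v) \<notin> parcs G"
      proof
        assume uv: "(u, v) \<in> parcs G"
        then have "u \<in> A" using False V by blast
        then have "non v < rank u" using adj uv symG by blast
        then show False using le False \<open>u \<in> A\<close> by (simp add: key_def)
      qed
      then show ?thesis using False by simp
    qed
  qed
  then have "word_graph {[0,0,1], [1,1,0]} (concat (map (\<lambda>x. if x \<in> A then [x] else [x, x]) zs)) = G"
    (is "word_graph _ ?w = G")
    using zs by (intro word_graph_double[OF G bip]) auto
  moreover have "pverts G \<noteq> {}" using G by (simp add: simple_graph_def)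
  then have "?w \<noteq> []" using zs(1) by (cases zs) auto
  ultimately show ?thesis by (intro exI[of _ ?w] conjI) (assumption, rule sym)
qed

theorem mainTheorem19:
  shows "word_graph_class {[0, 0, 1], [1, 1, 0]} = (bipartite_chain_graphs :: 'a pair_pre_digraph set)"
proof -
  have "G \<in> bipartite_chain_graphs \<longleftrightarrow> (\<exists>w. G = word_graph {[0, 0, 1], [1, 1, 0]} w \<and> w \<noteq> [])"
    for G :: "'a pair_pre_digraph"
    using word_graph_in_bipartite_chain_graphs bipartite_chain_graph_eq_word_graph[of G] by auto
  then show ?thesis
    unfolding word_graph_class_eq[OF exchange_closed_001_110] by (intro set_eqI) simp
qed

end
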